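(* For an irreducible fraction $\frac{r}{s}$, the following are equivalent: (1) $s$ is a multiple of $4$; (2) $\mathcal{S}_{\frac{r}{s}}(q)$ is divisible by $[4]_q=q^3+q^2+q+1$ in $\mathbb Z[q]$; (3) $\mathcal{S}_{\frac{r}{s}}(q)$ is divisible by $q^2+1$ in $\mathbb Z[q]$.
   Context: For an integer $c$, $[c]_q=\frac{1-q^c}{1-q}$. Every rational $\alpha>1$ has a unique negative continued fraction expansion $\alpha=c_1-\cfrac{1}{c_2-\cfrac{1}{\ddots-\cfrac{1}{c_l}}}$ with integers $c_j\ge 2$. Put $M^-_q(c)=\begin{pmatrix}[c]_q & -q^{c-1}\\ 1 & 0\end{pmatrix}$ and define $\mathcal{R}_\alpha(q),\mathcal{S}_\alpha(q)$ by $\begin{pmatrix}\mathcal{R}_\alpha(q)\\ \mathcal{S}_\alpha(q)\end{pmatrix}=M^-_q(c_1)\cdots M^-_q(c_l)\begin{pmatrix}1\\0\end{pmatrix}$. For rational $\alpha\le 1$ they are defined recursively by $\mathcal{S}_\alpha(q)=\mathcal{S}_{\alpha+1}(q)$ and $\mathcal{R}_\alpha(q)=q^{-1}(\mathcal{R}_{\alpha+1}(q)-\mathcal{S}_{\alpha+1}(q))$. $\mathcal{S}_\alpha(q)\in\mathbb Z[q]$, and $\mathcal{S}_{\frac rs}(1)=s$ for an irreducible fraction $\frac{r}{s}$ ($\gcd(r,s)=1$, $s>0$). *)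

theory Defs
  imports
    "HOL-Computational_Algebra.Computational_Algebra"
    "HOL-Analysis.Cartesian_Space"
begin

text \<open>
  The ring \<open>\<int>[q]\<close> is \<open>int poly\<close>, with \<open>q = [:0, 1:]\<close>; Laurent polynomials in \<open>q\<close> are taken
  inside \<open>int fls\<close>.  The bracket \<open>[c]\<^sub>q\<close> is only ever needed for \<open>c \<ge> 2\<close>, so \<open>c\<close> is a natural
  number; \<open>div\<close> is exact division in \<open>\<int>[q]\<close>, see \<open>q_int_eq_sum\<close>.
\<close>

definition q_int :: "nat \<Rightarrow> int poly" where
  "q_int c = (1 - [:0, 1:] ^ c) div (1 - [:0, 1:])"

lemma q_int_eq_sum: "q_int c = (\<Sum>i<c. [:0, 1:] ^ i)"
proof -
  have "1 - [:0, 1:] ^ c = (1 - [:0, 1 :: int:]) * (\<Sum>i<c. [:0, 1:] ^ i)"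
    by (rule one_diff_power_eq)
  moreover have "1 - [:0, 1 :: int:] \<noteq> 0"
    by (simp add: one_pCons)
  ultimately show ?thesis
    unfolding q_int_def by simp
qed

lemma q_int_4: "q_int 4 = [:0, 1:] ^ 3 + [:0, 1:] ^ 2 + [:0, 1:] + 1"
  by (simp add: q_int_eq_sum eval_nat_numeral)

fun neg_cf_val :: "nat list \<Rightarrow> rat" where
  "neg_cf_val [] = 0"
| "neg_cf_val [c] = of_nat c"
| "neg_cf_val (c # d # cs) = of_nat c - 1 / neg_cf_val (d # cs)"

definition is_neg_cf :: "rat \<Rightarrow> nat list \<Rightarrow> bool" where
  "is_neg_cf \<alpha> cs \<longleftrightarrow> cs \<noteq> [] \<and> (\<forall>c\<in>set cs. c \<ge> 2) \<and> neg_cf_val cs = \<alpha>"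

definition neg_cf :: "rat \<Rightarrow> nat list" where
  "neg_cf \<alpha> = (THE cs. is_neg_cf \<alpha> cs)"

lemma neg_cf_val_gt_1:
  "cs \<noteq> [] \<Longrightarrow> \<forall>c\<in>set cs. c \<ge> 2 \<Longrightarrow> neg_cf_val cs > 1"
proof (induction cs rule: neg_cf_val.induct)
  case (3 c d cs)
  then have "neg_cf_val (d # cs) > 1" by simp
  then have "1 / neg_cf_val (d # cs) < 1" by simp
  moreover have "(of_nat c :: rat) \<ge> of_nat 2"
    using 3 by (subst of_nat_le_iff) simp
  ultimately show ?case by simp
qed auto

lemma neg_cf_val_Cons:
  assumes "cs \<noteq> []"
  shows "neg_cf_val (c # cs) = of_nat c - 1 / neg_cf_val cs"
  using assms by (cases cs) auto

lemma is_neg_cf_hd: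
  assumes "is_neg_cf \<alpha> (c # cs)"
  shows "int c = \<lceil>\<alpha>\<rceil>"
proof (cases "cs = []")
  case False
  then have *: "\<alpha> = of_nat c - 1 / neg_cf_val cs" "neg_cf_val cs > 1"
    using assms neg_cf_val_gt_1[of cs] by (auto simp: is_neg_cf_def neg_cf_val_Cons)
  then have "1 / neg_cf_val cs < 1" "1 / neg_cf_val cs > 0" by auto
  with * show ?thesis by (intro ceiling_unique[symmetric]) auto
qed (use assms in \<open>auto simp: is_neg_cf_def\<close>)

lemma is_neg_cf_unique:
  "is_neg_cf \<alpha> cs \<Longrightarrow> is_neg_cf \<alpha> ds \<Longrightarrow> cs = ds"
proof (induction cs arbitrary: \<alpha> ds)
  case Nil
  then show ?case by (simp add: is_neg_cf_def)
next
  case (Cons c cs)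
  obtain d ds' where ds: "ds = d # ds'"
    using Cons.prems(2) by (cases ds) (auto simp: is_neg_cf_def)
  have cd: "c = d"
    using is_neg_cf_hd Cons.prems ds by (metis of_nat_eq_iff)
  have pos: "neg_cf_val xs > 1" if "xs \<noteq> []" "is_neg_cf \<alpha> (x # xs)" for x xs
    using that neg_cf_val_gt_1[of xs] by (auto simp: is_neg_cf_def)
  show ?case
  proof (cases "cs = [] \<or> ds' = []")
    case True
    have "cs = [] \<and> ds' = []"
    proof (rule ccontr)
      assume "\<not> ?thesis"
      with True consider "cs = []" "ds' \<noteq> []" | "cs \<noteq> []" "ds' = []" by blast
      then show False
      proof cases
        case 1
        then show False using Cons.prems cd ds pos[of ds' d]
          by (auto simp: is_neg_cf_def neg_cf_val_Cons)
      next
        case 2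
        then show False using Cons.prems cd ds pos[of cs c]
          by (auto simp: is_neg_cf_def neg_cf_val_Cons)
      qed
    qed
    then show ?thesis using ds cd by simp
  next
    case False
    then have "neg_cf_val cs = neg_cf_val ds'"
      using Cons.prems cd ds by (auto simp: is_neg_cf_def neg_cf_val_Cons)
    then have "is_neg_cf (neg_cf_val cs) cs" "is_neg_cf (neg_cf_val cs) ds'"
      using Cons.prems ds False by (auto simp: is_neg_cf_def)
    then show ?thesis using Cons.IH cd ds by blast
  qed
qed

lemma is_neg_cf_exists_quotient:
  fixes r s :: int
  assumes "0 < s" "s < r"
  shows "\<exists>cs. is_neg_cf (of_int r / of_int s) cs"
  using assms
proof (induction "nat s" arbitrary: r s rule: less_induct)
  case less
  define c where "c = (r + s - 1) div s"
  have c: "c * s \<ge> r" "c * s < r + s"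
  proof -
    have "c * s + (r + s - 1) mod s = r + s - 1"
      unfolding c_def by (rule div_mult_mod_eq)
    moreover have "0 \<le> (r + s - 1) mod s" "(r + s - 1) mod s < s"
      using less.prems by auto
    ultimately show "c * s \<ge> r" "c * s < r + s" by linarith+
  qed
  have "1 * s < c * s" using c less.prems by linarith
  then have "1 < c" using less.prems by (subst (asm) mult_less_cancel_right) auto
  then have c2: "c \<ge> 2" by simp
  define t where "t = c * s - r"
  show ?case
  proof (cases "t = 0")
    case True
    then have "(of_int r :: rat) = of_int c * of_int s"
      by (simp add: t_def flip: of_int_mult)
    then have "is_neg_cf (of_int r / of_int s) [nat c]"
      using c2 less.prems by (auto simp: is_neg_cf_def nat_le_iff le_nat_iff)
    then show ?thesis by blast
  next
    case False
    then have t: "0 < t" "t < s" using c by (auto simp: t_def)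
    then obtain cs where cs: "is_neg_cf (of_int s / of_int t) cs"
      using less.hyps[of t s] by auto
    have "(of_int r :: rat) = of_int c * of_int s - of_int t"
      by (simp add: t_def flip: of_int_mult of_int_diff)
    then have "(of_int r / of_int s :: rat) = of_nat (nat c) - 1 / (of_int s / of_int t)"
      using t c2 less.prems by (simp add: field_simps)
    then have "is_neg_cf (of_int r / of_int s) (nat c # cs)"
      using cs c2 by (auto simp: is_neg_cf_def neg_cf_val_Cons le_nat_iff)
    then show ?thesis by blast
  qed
qed

lemma is_neg_cf_ex1:
  assumes "\<alpha> > 1"
  shows "\<exists>!cs. is_neg_cf \<alpha> cs"
proof -
  obtain r s where "\<alpha> = Rat.Fract r s" "s > 0" by (cases \<alpha>) auto
  then have \<alpha>: "\<alpha> = of_int r / of_int s" "s > 0" by (auto simp: Fract_of_int_quotient)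
  then have "s < r" using assms by (simp add: less_divide_eq_1)
  then have "\<exists>cs. is_neg_cf \<alpha> cs" using is_neg_cf_exists_quotient \<alpha> by blast
  then show ?thesis using is_neg_cf_unique by blast
qed

lemma is_neg_cf_neg_cf: "\<alpha> > 1 \<Longrightarrow> is_neg_cf \<alpha> (neg_cf \<alpha>)"
  unfolding neg_cf_def by (rule theI', rule is_neg_cf_ex1)

definition M_minus :: "nat \<Rightarrow> int poly ^ 2 ^ 2" where
  "M_minus c = vector [vector [q_int c, - ([:0, 1:] ^ (c - 1))], vector [1, 0]]"

definition RS_vec :: "rat \<Rightarrow> int poly ^ 2" where
  "RS_vec \<alpha> = foldr (\<lambda>c A. M_minus c ** A) (neg_cf \<alpha>) (mat 1) *v vector [1, 0]"

function S_poly :: "rat \<Rightarrow> int poly" where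
  "S_poly \<alpha> = (if \<alpha> > 1 then RS_vec \<alpha> $ 2 else S_poly (\<alpha> + 1))"
  by auto
termination
  by (relation "measure (\<lambda>\<alpha>. nat \<lceil>2 - \<alpha>\<rceil>)") (auto, linarith)

declare S_poly.simps [simp del]

text \<open>
  For \<open>\<alpha> \<le> 1\<close> the numerator is in general only a Laurent polynomial, whereas the denominator
  stays in \<open>\<int>[q]\<close> and its recursion does not involve the numerator.
\<close>

function R_laurent :: "rat \<Rightarrow> int fls" where
  "R_laurent \<alpha> =
    (if \<alpha> > 1 then fps_to_fls (fps_of_poly (RS_vec \<alpha> $ 1))
     else fls_X_inv * (R_laurent (\<alpha> + 1) - fps_to_fls (fps_of_poly (S_poly (\<alpha> + 1)))))"
  by auto
termination
  by (relation "measure (\<lambda>\<alpha>. nat \<lceil>2 - \<alpha>\<rceil>)") (auto, linarith)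

declare R_laurent.simps [simp del]

end

theory Submission imports Defs begin

text \<open>
  Reading the continued fraction from the right, the pair \<open>(R, S)\<close> evolves by
  \<open>(R, S) \<mapsto> ([c]\<^sub>q R - q\<^sup>c\<^sup>-\<^sup>1 S, R)\<close>.  At \<open>q = 1\<close> it is the reduced pair \<open>(r, s)\<close>.  At \<open>q = \<i>\<close> the
  step depends only on \<open>c mod 4\<close>, and the point \<open>R(\<i>) : S(\<i>)\<close> of the projective line runs
  through an orbit of six elements, in bijection with the projective line over \<open>\<int>/4\<close>;
  this bijection matches \<open>r : s\<close> with \<open>R(\<i>) : S(\<i>)\<close>, so \<open>S(\<i>) = 0\<close> iff \<open>4\<close> divides \<open>s\<close>.  In the
  same way \<open>q = -1\<close> corresponds to the projective line over \<open>\<int>/2\<close>, and \<open>S(-1) = 0\<close> iff \<open>s\<close> is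
  even.
\<close>

section \<open>Evaluation at \<open>\<i>\<close> and divisibility by \<open>q^2 + 1\<close> and
  \<open>[4]_q\<close>\<close>

abbreviation poly_at_i :: "int poly \<Rightarrow> complex" where
  "poly_at_i p \<equiv> poly (map_poly of_int p) \<i>"

lemma poly_at_i_pCons: "poly_at_i (pCons a p) = of_int a + \<i> * poly_at_i p"
  by (simp add: map_poly_pCons)

lemma poly_at_i_add: "poly_at_i (p + r) = poly_at_i p + poly_at_i r"
  by (induction p r rule: poly_induct2) (simp_all add: poly_at_i_pCons algebra_simps)

lemma poly_at_i_smult: "poly_at_i (smult a p) = of_int a * poly_at_i p"
  by (induction p) (simp_all add: poly_at_i_pCons algebra_simps)

lemma poly_at_i_diff: "poly_at_i (p - r) = poly_at_i p - poly_at_i r"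
  using poly_at_i_add[of "p - r" r] by simp

lemma poly_at_i_mult: "poly_at_i (p * r) = poly_at_i p * poly_at_i r"
  by (induction p) (simp_all add: poly_at_i_pCons poly_at_i_add poly_at_i_smult algebra_simps)

lemma poly_at_i_power: "poly_at_i (p ^ n) = poly_at_i p ^ n"
  by (induction n) (simp_all add: poly_at_i_mult)

lemma poly_at_i_sum: "poly_at_i (sum f A) = (\<Sum>x\<in>A. poly_at_i (f x))"
  by (induction A rule: infinite_finite_induct) (simp_all add: poly_at_i_add)

text \<open>The divisor is monic, so division with remainder works over the integers.\<close>

lemma ex_div_q2_plus_1:
  "\<exists>t a b. (p :: int poly) = ([:0, 1:] ^ 2 + 1) * t + [:a, b:]"
proof (induction p)
  case 0
  have "0 = ([:0, 1:] ^ 2 + 1) * 0 + [:0, 0 :: int:]" by simp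
  then show ?case by blast
next
  case (pCons c p)
  then obtain t a b where "p = ([:0, 1:] ^ 2 + 1) * t + [:a, b:]" by blast
  \<comment> \<open>Horner step:
    \<open>q * (a + b * q) = b * (q^2 + 1) + (a * q - b)\<close>.\<close>
  then have "pCons c p = ([:0, 1:] ^ 2 + 1) * ([:0, 1:] * t + [:b:]) + [:c - b, a:]"
    by (simp add: power2_eq_square one_pCons algebra_simps)
  then show ?case by blast
qed

text \<open>A remainder \<open>a + b * q\<close> with integers \<open>a\<close>, \<open>b\<close>
  vanishes at \<open>\<i>\<close> only if \<open>a = b = 0\<close>.\<close>

lemma q2_plus_1_dvd_iff: "[:0, 1:] ^ 2 + 1 dvd p \<longleftrightarrow> poly_at_i p = 0"
proof
  assume "[:0, 1:] ^ 2 + 1 dvd p"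
  then show "poly_at_i p = 0"
    by (auto simp: dvd_def poly_at_i_mult poly_at_i_add poly_at_i_power poly_at_i_pCons)
next
  assume p0: "poly_at_i p = 0"
  obtain t a b where p: "p = ([:0, 1:] ^ 2 + 1) * t + [:a, b:]"
    using ex_div_q2_plus_1 by blast
  have "of_int a + \<i> * of_int b = 0"
    using p0 unfolding p
    by (simp add: poly_at_i_mult poly_at_i_add poly_at_i_power poly_at_i_pCons)
  then have "a = 0" "b = 0" by (auto simp: complex_eq_iff)
  then show "[:0, 1:] ^ 2 + 1 dvd p" using p by simp
qed

lemma q_int_4_factor: "q_int 4 = [:1, 1:] * ([:0, 1:] ^ 2 + 1)"
  by (simp add: q_int_4 power2_eq_square power3_eq_cube one_pCons)

text \<open>After \<open>q + 1\<close> is split off, the cofactor still has the root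
  \<open>\<i>\<close>, since \<open>1 + \<i>\<close> is nonzero.\<close>

lemma q_int_4_dvd_iff: "q_int 4 dvd p \<longleftrightarrow> poly p (-1) = 0 \<and> poly_at_i p = 0"
proof
  assume "q_int 4 dvd p"
  then have "[:1, 1:] dvd p" "[:0, 1:] ^ 2 + 1 dvd p"
    unfolding q_int_4_factor by (blast dest: dvd_mult_left dvd_mult_right)+
  then show "poly p (-1) = 0 \<and> poly_at_i p = 0"
    by (simp add: poly_eq_0_iff_dvd q2_plus_1_dvd_iff)
next
  assume *: "poly p (-1) = 0 \<and> poly_at_i p = 0"
  then obtain t where p: "p = [:1, 1:] * t"
    by (auto simp: poly_eq_0_iff_dvd dvd_def)
  have "1 + \<i> \<noteq> 0" by (simp add: complex_eq_iff)
  then have "poly_at_i t = 0"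
    using * unfolding p poly_at_i_mult by (simp add: poly_at_i_pCons)
  then have "[:0, 1:] ^ 2 + 1 dvd t" by (simp add: q2_plus_1_dvd_iff)
  then show "q_int 4 dvd p" unfolding p q_int_4_factor by (rule mult_dvd_mono[OF dvd_refl])
qed

section \<open>Continued fraction vectors and their values at \<open>q = 1\<close>\<close>

text \<open>\<open>RS_vec\<close> freed from \<open>neg_cf\<close>: an arbitrary list makes
  induction available.\<close>

definition cf_vec :: "nat list \<Rightarrow> int poly ^ 2" where
  "cf_vec cs = foldr (\<lambda>c A. M_minus c ** A) cs (mat 1) *v vector [1, 0]"

lemma cf_vec_Nil: "cf_vec [] $ 1 = 1" "cf_vec [] $ 2 = 0"
  by (simp_all add: cf_vec_def)

lemma cf_vec_Cons:
  "cf_vec (c # cs) $ 1 = q_int c * cf_vec cs $ 1 - [:0, 1:] ^ (c - 1) * cf_vec cs $ 2"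
  "cf_vec (c # cs) $ 2 = cf_vec cs $ 1"
proof -
  have "cf_vec (c # cs) = M_minus c *v cf_vec cs"
    by (simp add: cf_vec_def matrix_vector_mul_assoc)
  then show "cf_vec (c # cs) $ 1 = q_int c * cf_vec cs $ 1 - [:0, 1:] ^ (c - 1) * cf_vec cs $ 2"
    "cf_vec (c # cs) $ 2 = cf_vec cs $ 1"
    by (simp_all add: M_minus_def matrix_vector_mult_def sum_2)
qed

lemma cf_vec_at_1_Cons:
  "poly (cf_vec (c # cs) $ 1) 1 = int c * poly (cf_vec cs $ 1) 1 - poly (cf_vec cs $ 2) 1"
  by (simp add: cf_vec_Cons q_int_eq_sum poly_sum)

text \<open>At \<open>q = 1\<close> the step \<open>(x, y) \<mapsto> (c * x - y, x)\<close> has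
  determinant 1.\<close>

lemma coprime_cf_vec_at_1: "coprime (poly (cf_vec cs $ 1) 1) (poly (cf_vec cs $ 2) 1)"
proof (induction cs)
  case Nil
  then show ?case by (simp add: cf_vec_Nil)
next
  case (Cons c cs)
  have "coprime (int c * x - y) x" if "coprime x y" for x y :: int
  proof (rule coprimeI)
    fix d assume d: "d dvd int c * x - y" "d dvd x"
    then have "d dvd int c * x - (int c * x - y)" by (metis dvd_diff dvd_mult)
    then show "is_unit d" using d(2) that coprime_common_divisor[of x y d] by simp
  qed
  then show ?case using Cons by (simp add: cf_vec_at_1_Cons cf_vec_Cons(2))
qed

text \<open>On fractions \<open>x / y\<close> the step at \<open>q = 1\<close> is
  \<open>c - 1 / (x / y)\<close>. It keeps both entries positive because the value of a nonempty
  tail exceeds 1.\<close>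

lemma cf_vec_at_1_value:
  assumes "cs \<noteq> []" "\<forall>c\<in>set cs. c \<ge> 2"
  shows "poly (cf_vec cs $ 2) 1 > 0 \<and> poly (cf_vec cs $ 1) 1 > 0 \<and>
    neg_cf_val cs = of_int (poly (cf_vec cs $ 1) 1) / of_int (poly (cf_vec cs $ 2) 1)"
  using assms
proof (induction cs)
  case Nil
  then show ?case by simp
next
  case (Cons c cs)
  show ?case
  proof (cases "cs = []")
    case True
    then show ?thesis using Cons.prems
      by (simp add: cf_vec_at_1_Cons cf_vec_Cons(2) cf_vec_Nil)
  next
    case False
    define x y where "x = poly (cf_vec cs $ 1) 1" and "y = poly (cf_vec cs $ 2) 1"
    have xy: "x > 0" "y > 0" "neg_cf_val cs = of_int x / of_int y"
      using Cons False by (auto simp: x_def y_def)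
    have "neg_cf_val cs > 1" "neg_cf_val (c # cs) > 1"
      using Cons.prems False by (auto intro!: neg_cf_val_gt_1)
    then have "x > y" using xy by (simp add: less_divide_eq_1)
    moreover have "int c * x \<ge> 1 * x"
      using Cons.prems xy by (intro mult_right_mono) auto
    ultimately have "int c * x - y > 0" by linarith
    moreover have "neg_cf_val (c # cs) = of_int (int c * x - y) / of_int x"
      using xy(1,2) False by (simp add: neg_cf_val_Cons xy(3) field_simps)
    ultimately show ?thesis
      using xy by (simp add: cf_vec_at_1_Cons cf_vec_Cons(2) flip: x_def y_def)
  qed
qed

section \<open>Values at \<open>\<i>\<close> against residues modulo 4\<close>

text \<open>
  The points \<open>0, 1, 2, 3, \<infinity>, 1/2\<close> of the projective line over \<open>\<int>/4\<close> correspond to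
  \<open>0, 1, 1 + \<i>, \<i>, \<infinity>, 1/(1 - \<i>)\<close>.
\<close>
definition match_mod4 :: "int \<Rightarrow> int \<Rightarrow> complex \<Rightarrow> complex \<Rightarrow> bool" where
  "match_mod4 x y X Y \<longleftrightarrow>
    4 dvd x \<and> odd y \<and> X = 0 \<and> Y \<noteq> 0 \<or>
    4 dvd x - y \<and> odd y \<and> X = Y \<and> Y \<noteq> 0 \<or>
    4 dvd x - 2 * y \<and> odd y \<and> X = (1 + \<i>) * Y \<and> Y \<noteq> 0 \<or>
    4 dvd x - 3 * y \<and> odd y \<and> X = \<i> * Y \<and> Y \<noteq> 0 \<or>
    odd x \<and> 4 dvd y \<and> X \<noteq> 0 \<and> Y = 0 \<or>
    odd x \<and> 4 dvd y - 2 * x \<and> X \<noteq> 0 \<and> Y = (1 - \<i>) * X"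

text \<open>Only the fifth case has \<open>Y = 0\<close>, and in all others \<open>y\<close> is odd
  or congruent to 2 modulo 4.\<close>

lemma match_mod4_dvd_iff: "match_mod4 x y X Y \<Longrightarrow> Y = 0 \<longleftrightarrow> 4 dvd y"
proof -
  have [simp]: "1 - \<i> \<noteq> 0" by (simp add: complex_eq_iff)
  assume "match_mod4 x y X Y"
  then show ?thesis unfolding match_mod4_def
    by (elim disjE conjE) (simp_all, presburger+)
qed

text \<open>The premises always come as congruence, parity, equation, nonvanishing, so that one
  proof pattern fits all six rules.\<close>

lemma match_mod4_intros:
  "4 dvd x \<Longrightarrow> odd y \<Longrightarrow> X = 0 \<Longrightarrow> Y \<noteq> 0 \<Longrightarrow> match_mod4 x y X Y"
  "4 dvd x - y \<Longrightarrow> odd y \<Longrightarrow> X = Y \<Longrightarrow> Y \<noteq> 0 \<Longrightarrow> match_mod4 x y X Y"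
  "4 dvd x - 2 * y \<Longrightarrow> odd y \<Longrightarrow> X = (1 + \<i>) * Y \<Longrightarrow> Y \<noteq> 0 \<Longrightarrow> match_mod4 x y X Y"
  "4 dvd x - 3 * y \<Longrightarrow> odd y \<Longrightarrow> X = \<i> * Y \<Longrightarrow> Y \<noteq> 0 \<Longrightarrow> match_mod4 x y X Y"
  "4 dvd y \<Longrightarrow> odd x \<Longrightarrow> Y = 0 \<Longrightarrow> X \<noteq> 0 \<Longrightarrow> match_mod4 x y X Y"
  "4 dvd y - 2 * x \<Longrightarrow> odd x \<Longrightarrow> Y = (1 - \<i>) * X \<Longrightarrow> X \<noteq> 0 \<Longrightarrow> match_mod4 x y X Y"
  by (simp_all add: match_mod4_def)

text \<open>The summand \<open>4 * m\<close> is invisible modulo 4, which leaves four residues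
  \<open>j\<close> for each of six cases. The factor \<open>\<i> * \<i> ^ j\<close> equals
  \<open>- (\<i> ^ j / \<i>)\<close>, the value of \<open>- q^(j-1)\<close>, and makes sense for
  \<open>j = 0\<close> too.\<close>

lemma match_mod4_step:
  assumes "match_mod4 x y X Y" "j < 4"
  shows "match_mod4 (int (4 * m + j) * x - y) x ((\<Sum>k<j. \<i> ^ k) * X + \<i> * \<i> ^ j * Y) X"
proof -
  \<comment> \<open>Naming the product keeps the congruences linear for
    \<open>presburger\<close>.\<close>
  define z where "z = int m * x"
  have x': "int (4 * m + j) * x - y = 4 * z + int j * x - y"
    by (simp add: z_def algebra_simps)
  have ii: "\<i> * (\<i> * w) = - w" for w by (simp flip: mult.assoc)
  have step: "match_mod4 (4 * z - y) x (\<i> * Y) X \<and>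
    match_mod4 (4 * z + x - y) x (X - Y) X \<and>
    match_mod4 (4 * z + 2 * x - y) x ((1 + \<i>) * X - \<i> * Y) X \<and>
    match_mod4 (4 * z + 3 * x - y) x (\<i> * X + Y) X"
    using assms(1) unfolding match_mod4_def[of x y]
    \<comment> \<open>The six cases exclude each other modulo 4, so a wrong rule already fails at
      its congruence or parity premise.\<close>
    by - (elim disjE conjE; hypsubst; intro conjI;
        (rule match_mod4_intros(1), presburger, presburger,
            simp add: algebra_simps ii, simp add: algebra_simps ii
          | rule match_mod4_intros(2), presburger, presburger,
            simp add: algebra_simps ii, simp add: algebra_simps ii
          | rule match_mod4_intros(3), presburger, presburger,
            simp add: algebra_simps ii, simp add: algebra_simps ii
          | rule match_mod4_intros(4), presburger, presburger,
            simp add: algebra_simps ii, simp add: algebra_simps ii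
          | rule match_mod4_intros(5), presburger, presburger,
            simp add: algebra_simps ii, simp add: algebra_simps ii
          | rule match_mod4_intros(6), presburger, presburger,
            simp add: algebra_simps ii, simp add: algebra_simps ii))
  consider "j = 0" | "j = 1" | "j = 2" | "j = 3" using assms(2) by linarith
  then show ?thesis
    unfolding x' by cases (use step in \<open>simp_all add: numeral_3_eq_3 numeral_2_eq_2 ii\<close>)
qed

text \<open>Four consecutive powers of \<open>\<i>\<close> sum to 0.\<close>

lemma q_int_at_i: "poly_at_i (q_int (4 * m + j)) = (\<Sum>k<j. \<i> ^ k)"
proof -
  have "(\<Sum>k<4 * m + j. \<i> ^ k) = (\<Sum>k<j. \<i> ^ k)"
  proof (induction m)
    case (Suc m)
    have "4 * Suc m + j = Suc (Suc (Suc (Suc (4 * m + j))))" by simp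
    then show ?case using Suc by (simp only: sum.lessThan_Suc power_Suc) (simp flip: mult.assoc)
  qed simp
  then show ?thesis
    by (simp add: q_int_eq_sum poly_at_i_sum poly_at_i_power poly_at_i_pCons)
qed

lemma match_mod4_cf_vec:
  assumes "\<forall>c\<in>set cs. c > 0"
  shows "match_mod4 (poly (cf_vec cs $ 1) 1) (poly (cf_vec cs $ 2) 1)
    (poly_at_i (cf_vec cs $ 1)) (poly_at_i (cf_vec cs $ 2))"
  using assms
proof (induction cs)
  case Nil
  then show ?case by (simp add: cf_vec_Nil match_mod4_def)
next
  case (Cons c cs)
  define m j where "m = c div 4" and "j = c mod 4"
  have c: "c = 4 * m + j" "j < 4" by (simp_all add: m_def j_def)
  \<comment> \<open>Positivity of \<open>c\<close> makes the natural-number subtraction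
    \<open>c - 1\<close> exact.\<close>
  have "\<i> * \<i> ^ (c - 1) = \<i> ^ c"
    using Cons.prems by (simp flip: power_Suc)
  also have "\<i> ^ c = \<i> ^ j" by (simp add: c power_add power_mult)
  finally have "\<i> ^ (c - 1) = - (\<i> * \<i> ^ j)"
    by (metis complex_i_mult_minus minus_minus)
  then have "poly_at_i (cf_vec (c # cs) $ 1) =
      (\<Sum>k<j. \<i> ^ k) * poly_at_i (cf_vec cs $ 1) + \<i> * \<i> ^ j * poly_at_i (cf_vec cs $ 2)"
    using q_int_at_i[of m j]
    by (simp add: cf_vec_Cons poly_at_i_diff poly_at_i_mult poly_at_i_power poly_at_i_pCons flip: c(1))
  then show ?case
    using match_mod4_step[of _ _ _ _ j m] Cons c
    by (simp add: cf_vec_at_1_Cons cf_vec_Cons(2))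
qed

section \<open>Values at \<open>-1\<close> against residues modulo 2\<close>

text \<open>The points 0, 1, \<infinity> of the projective line over the field with two elements
  correspond to the ratios 0, 1, \<infinity> of \<open>X\<close> to \<open>Y\<close>.\<close>

definition match_mod2 :: "int \<Rightarrow> int \<Rightarrow> int \<Rightarrow> int \<Rightarrow> bool" where
  "match_mod2 x y X Y \<longleftrightarrow>
    even x \<and> odd y \<and> X = 0 \<and> Y \<noteq> 0 \<or>
    odd x \<and> odd y \<and> X = Y \<and> Y \<noteq> 0 \<or>
    odd x \<and> even y \<and> X \<noteq> 0 \<and> Y = 0"

lemma match_mod2_even_iff: "match_mod2 x y X Y \<Longrightarrow> Y = 0 \<longleftrightarrow> even y"
  by (auto simp: match_mod2_def)

lemma q_int_at_minus_1: "poly (q_int c) (-1) = (if even c then 0 else 1)"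
  by (induction c) (auto simp: q_int_eq_sum poly_sum)

lemma match_mod2_cf_vec:
  assumes "\<forall>c\<in>set cs. c > 0"
  shows "match_mod2 (poly (cf_vec cs $ 1) 1) (poly (cf_vec cs $ 2) 1)
    (poly (cf_vec cs $ 1) (-1)) (poly (cf_vec cs $ 2) (-1))"
  using assms
proof (induction cs)
  case Nil
  then show ?case by (simp add: cf_vec_Nil match_mod2_def)
next
  case (Cons c cs)
  \<comment> \<open>The new first entry is \<open>Y\<close> for even \<open>c\<close> and
    \<open>X - Y\<close> for odd \<open>c\<close>.\<close>
  have "match_mod2 (int c * x - y) x (poly (q_int c) (-1) * X - (-1) ^ (c - 1) * Y) X"
    if "match_mod2 x y X Y" for x y X Y
    using that Cons.prems unfolding match_mod2_def by (cases "even c") (auto simp: q_int_at_minus_1)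
  then show ?case
    using Cons by (simp add: cf_vec_at_1_Cons) (simp add: cf_vec_Cons)
qed

section \<open>Zeros of \<open>S_poly\<close> at \<open>\<i>\<close> and \<open>-1\<close>, and the
  equivalences\<close>

lemma S_poly_zero_iff:
  assumes "coprime r s" "s > 0"
  defines "S \<equiv> S_poly (of_int r / of_int s)"
  shows "(poly_at_i S = 0 \<longleftrightarrow> 4 dvd s) \<and> (poly S (-1) = 0 \<longleftrightarrow> even s)"
proof -
  \<comment> \<open>The numerator is generalised, since the recursion to \<open>\<alpha> + 1\<close>
    turns \<open>r\<close> into \<open>r + s\<close> and keeps \<open>s\<close>.\<close>
  have "(poly_at_i (S_poly \<alpha>) = 0 \<longleftrightarrow> 4 dvd s) \<and> (poly (S_poly \<alpha>) (-1) = 0 \<longleftrightarrow> even s)"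
    if "\<alpha> = of_int r / of_int s" "coprime r s" for \<alpha> r
    using that
  proof (induction \<alpha> arbitrary: r rule: S_poly.induct)
    case (1 \<alpha>)
    show ?case
    proof (cases "\<alpha> > 1")
      case True
      define cs where "cs = neg_cf \<alpha>"
      have cs: "cs \<noteq> []" "\<forall>c\<in>set cs. c \<ge> 2" "neg_cf_val cs = \<alpha>"
        using is_neg_cf_neg_cf[OF True] by (auto simp: is_neg_cf_def cs_def)
      have S: "S_poly \<alpha> = cf_vec cs $ 2"
        using True by (simp add: S_poly.simps RS_vec_def cf_vec_def cs_def)
      define x y where "x = poly (cf_vec cs $ 1) 1" and "y = poly (cf_vec cs $ 2) 1"
      have y: "y > 0" "\<alpha> = of_int x / of_int y" "coprime x y"
        using cf_vec_at_1_value[OF cs(1,2)] coprime_cf_vec_at_1[of cs] cs(3)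
        by (simp_all add: x_def y_def)
      \<comment> \<open>Reduced fractions with positive denominator are unique, hence the value of
        \<open>S_poly \<alpha>\<close> at 1 is \<open>s\<close>.\<close>
      have "quotient_of \<alpha> = (x, y)" "quotient_of \<alpha> = (r, s)"
        using y 1(2,3) \<open>s > 0\<close>
        by (metis Fract_of_int_quotient normalize_stable quotient_of_Fract)+
      then have "y = s" by simp
      moreover have "\<forall>c\<in>set cs. c > 0" using cs(2) by force
      ultimately show ?thesis
        using match_mod4_dvd_iff[OF match_mod4_cf_vec] match_mod2_even_iff[OF match_mod2_cf_vec]
        by (metis S y_def)
    next
      case False
      have "\<alpha> + 1 = of_int (r + s) / of_int s" "coprime (r + s) s"
        using 1(2,3) \<open>s > 0\<close> by (simp_all add: field_simps coprime_iff_gcd_eq_1)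
      then show ?thesis
        using "1.IH"[OF False] False by (metis S_poly.simps[of \<alpha>])
    qed
  qed
  then show ?thesis using assms by blast
qed

theorem theorem7p6:
  fixes r s :: int
  assumes "coprime r s" and "s > 0"
  shows "(4 dvd s \<longleftrightarrow> q_int 4 dvd S_poly (of_int r / of_int s)) \<and>
         (q_int 4 dvd S_poly (of_int r / of_int s) \<longleftrightarrow>
           [:0, 1:] ^ 2 + 1 dvd S_poly (of_int r / of_int s))"
proof -
  \<comment> \<open>Thus a zero of the denominator polynomial at \<open>\<i>\<close> forces one at
    \<open>-1\<close>, and \<open>q^2 + 1\<close> brings the factor \<open>q + 1\<close> with
    it.\<close>
  have "4 dvd s \<Longrightarrow> even s" by presburger
  then show ?thesis
    using S_poly_zero_iff[OF assms] by (auto simp: q_int_4_dvd_iff q2_plus_1_dvd_iff)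
qed

end
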